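(* For every $n\ge1$ and every $\pi\in\mathrm{PC}(n)$ let $a(\pi)\in\mathbb{C}$ be an arbitrary complex number, and let $a_n=\sum_{\pi\in\mathrm{PC}(n)}a(\pi)$, $A(x)=\sum_{n=1}^\infty a_nx^n$. Let $b(\pi)$, for $\pi\in\mathrm{PC}^+(n)$, be the associated weights described in the context, and let $b_n=\sum_{\pi\in\mathrm{PC}^+(n)}b(\pi)$, $B(x)=\sum_{n=1}^\infty b_nx^n$. Then $b_1=1$ and, for every $n\ge2$, $b_n=a_n+a_{n-1}$. Thus, as formal power series, $$B(x)=x+(1+x)A(x).$$
   Context: $[n]=\{1,\ldots,n\}$ and $\mathcal{P}(n)$ is the set of all set partitions of $[n]$. For $\pi\in\mathcal{P}(n)$, write $i\overset{\pi}{\sim}j$ if $i,j$ lie in the same block of $\pi$. A subset $S\subseteq[n]$ splits $\pi$ if $S$ is a union of some of the blocks of $\pi$. Consider, for $\pi\in\mathcal{P}(n)$, $n\ge1$, the conditions: (a) no proper subinterval $\{p+1,p+2,\ldots,p+q\}$ of $[n]$ (with $0\le p<p+q\le n$ and $q<n$) splits $\pi$; (b) $k\not\overset{\pi}{\sim}k+1$ for all $k\in[n-1]$; (c) $1\not\overset{\pi}{\sim}n$. $\mathrm{PC}(n)$ (the purely crossing partitions) is the set of $\pi\in\mathcal{P}(n)$ satisfying (a), (b) and (c). $\mathrm{PC}^+(n)$ is the set of $\pi\in\mathcal{P}(n)$ satisfying (a) and (b). (Since $1\sim 1$, $\mathrm{PC}(1)=\emptyset$.) $0_1$ denotes the unique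 partition of $[1]$. One has $\mathrm{PC}^+(1)=\{0_1\}$ and, for $n\ge2$, $\mathrm{PC}^+(n)$ is the disjoint union of $\mathrm{PC}(n)$ and $\{\tilde\sigma\mid\sigma\in\mathrm{PC}(n-1)\}$, where $\tilde\sigma$ is obtained from $\sigma$ by adjoining $n$ to the block of $\sigma$ that contains $1$. Weights: $b(0_1)=1$; for $n\ge2$ and $\pi\in\mathrm{PC}^+(n)$, $b(\pi)=a(\pi)$ if $\pi\in\mathrm{PC}(n)$, and $b(\pi)=a(\sigma)$ if $\pi=\tilde\sigma$ with $\sigma\in\mathrm{PC}(n-1)$. *)

theory Defs
  imports
    Complex_Main
    "HOL-Library.Disjoint_Sets"
    "HOL-Computational_Algebra.Formal_Power_Series"
begin

text \<open>A set partition of \<open>[n] = {1..n}\<close> is its set of blocks \<open>\<pi> :: nat set set\<close>,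
  with \<^term>\<open>partition_on {1..n} \<pi>\<close>. Since \<open>\<Union>\<pi> = {1..n}\<close>, the partition determines \<open>n\<close>.\<close>

definition same_block :: "nat set set \<Rightarrow> nat \<Rightarrow> nat \<Rightarrow> bool" where
  "same_block \<pi> i j \<longleftrightarrow> (\<exists>B\<in>\<pi>. i \<in> B \<and> j \<in> B)"

definition splits :: "nat set \<Rightarrow> nat set set \<Rightarrow> bool" where
  "splits S \<pi> \<longleftrightarrow> (\<exists>T. T \<subseteq> \<pi> \<and> S = \<Union>T)"

definition no_interval_splits :: "nat \<Rightarrow> nat set set \<Rightarrow> bool" where
  "no_interval_splits n \<pi> \<longleftrightarrow>
     (\<forall>p q. p < p + q \<and> p + q \<le> n \<and> q < n \<longrightarrow> \<not> splits {p + 1..p + q} \<pi>)"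

definition no_neighbours :: "nat \<Rightarrow> nat set set \<Rightarrow> bool" where
  "no_neighbours n \<pi> \<longleftrightarrow> (\<forall>k\<in>{1..n - 1}. \<not> same_block \<pi> k (k + 1))"

text \<open>Both families are indexed by \<open>n \<ge> 1\<close>; for \<open>n = 0\<close> they are empty by convention.\<close>

definition PC_plus :: "nat \<Rightarrow> nat set set set" where
  "PC_plus n = {\<pi>. n \<ge> 1 \<and> partition_on {1..n} \<pi> \<and>
     no_interval_splits n \<pi> \<and> no_neighbours n \<pi>}"

definition PC :: "nat \<Rightarrow> nat set set set" where
  "PC n = {\<pi>. n \<ge> 1 \<and> partition_on {1..n} \<pi> \<and>
     no_interval_splits n \<pi> \<and> no_neighbours n \<pi> \<and> \<not> same_block \<pi> 1 n}"

text \<open>\<open>adjoin_to_first n \<sigma>\<close> is the partition \<open>\<sigma>\<close>-tilde of \<open>[n]\<close>, for \<open>\<sigma>\<close> a partition of \<open>[n - 1]\<close>.\<close>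

definition adjoin_to_first :: "nat \<Rightarrow> nat set set \<Rightarrow> nat set set" where
  "adjoin_to_first n \<sigma> = (\<lambda>B. if 1 \<in> B then insert n B else B) ` \<sigma>"

text \<open>The weight \<open>b(\<pi>)\<close> of \<open>\<pi> \<in> PC_plus n\<close>; \<open>{{1}}\<close> is the partition \<open>0\<^sub>1\<close> of \<open>[1]\<close>.
  On \<open>PC_plus n - PC n\<close> with \<open>n \<ge> 2\<close> there is exactly one \<open>\<sigma>\<close> as described.\<close>

definition b_weight :: "(nat set set \<Rightarrow> complex) \<Rightarrow> nat \<Rightarrow> nat set set \<Rightarrow> complex" where
  "b_weight a n \<pi> =
     (if \<pi> = {{1}} then 1
      else if \<pi> \<in> PC n then a \<pi>
      else a (THE \<sigma>. \<sigma> \<in> PC (n - 1) \<and> \<pi> = adjoin_to_first n \<sigma>))"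

definition a_sum :: "(nat set set \<Rightarrow> complex) \<Rightarrow> nat \<Rightarrow> complex" where
  "a_sum a n = (\<Sum>\<pi>\<in>PC n. a \<pi>)"

definition b_sum :: "(nat set set \<Rightarrow> complex) \<Rightarrow> nat \<Rightarrow> complex" where
  "b_sum a n = (\<Sum>\<pi>\<in>PC_plus n. b_weight a n \<pi>)"

definition A_series :: "(nat set set \<Rightarrow> complex) \<Rightarrow> complex fps" where
  "A_series a = Abs_fps (\<lambda>n. if n = 0 then 0 else a_sum a n)"

definition B_series :: "(nat set set \<Rightarrow> complex) \<Rightarrow> complex fps" where
  "B_series a = Abs_fps (\<lambda>n. if n = 0 then 0 else b_sum a n)"

end

theory Submission
  imports Defs
begin

text \<open>For \<open>n \<ge> 2\<close>, \<open>PC_plus n\<close> splits according to whether 1 and \<open>n\<close> share a block. If they do,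
  deleting \<open>n\<close> inverts \<open>adjoin_to_first n\<close>: condition (c) for the smaller partition is condition
  (b) for the larger one at \<open>k = n - 1\<close>, and an interval splitting the smaller partition, or its
  complement when it contains 1, splits the larger one. Hence \<open>adjoin_to_first n\<close> is a
  weight-preserving bijection from \<open>PC (n - 1)\<close> onto \<open>PC_plus n - PC n\<close>.\<close>

section \<open>Blocks, and splitting as closure under \<open>same_block\<close>\<close>

lemma partition_on_block_eq:
  "\<lbrakk>partition_on A \<pi>; B \<in> \<pi>; C \<in> \<pi>; x \<in> B; x \<in> C\<rbrakk> \<Longrightarrow> B = C"
  by (auto simp: partition_on_def disjoint_def)

lemma same_block_sym: "same_block \<pi> i j \<Longrightarrow> same_block \<pi> j i"
  by (auto simp: same_block_def)

lemma same_block_refl_iff: "partition_on A \<pi> \<Longrightarrow> same_block \<pi> i i \<longleftrightarrow> i \<in> A"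
  by (auto simp: same_block_def partition_on_def)

lemma same_block_mem:
  assumes "partition_on A \<pi>" "same_block \<pi> i j"
  shows "i \<in> A" "j \<in> A"
  using assms by (auto simp: same_block_def partition_on_def)

lemma splitsD:
  assumes "partition_on A \<pi>" and "splits S \<pi>" "i \<in> S" "same_block \<pi> i j"
  shows "j \<in> S"
  using assms(2-) partition_on_block_eq[OF assms(1)] unfolding splits_def same_block_def by blast

text \<open>The witness is the family of blocks meeting \<open>S\<close>: closure puts each of them
  inside \<open>S\<close>, and \<open>S \<subseteq> A\<close> makes them cover \<open>S\<close>.
  With \<open>splitsD\<close> this lets later arguments test single pairs \<open>i\<close>,
  \<open>j\<close> instead of families of blocks.\<close>

lemma splitsI:
  assumes \<pi>: "partition_on A \<pi>" and S: "S \<subseteq> A"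
    and closed: "\<And>i j. \<lbrakk>i \<in> S; same_block \<pi> i j\<rbrakk> \<Longrightarrow> j \<in> S"
  shows "splits S \<pi>"
proof -
  have "S = \<Union>{B\<in>\<pi>. B \<inter> S \<noteq> {}}"
    using closed S partition_onD1[OF \<pi>] unfolding same_block_def by blast
  then show ?thesis
    unfolding splits_def by (metis (no_types, lifting) mem_Collect_eq subsetI)
qed

text \<open>A set closed under a symmetric relation has a closed complement.\<close>

lemma splits_Diff:
  assumes \<pi>: "partition_on A \<pi>" and "splits S \<pi>"
  shows "splits (A - S) \<pi>"
proof (rule splitsI[OF \<pi>])
  show "j \<in> A - S" if "i \<in> A - S" "same_block \<pi> i j" for i j
    using that same_block_mem(2)[OF \<pi>] splitsD[OF assms _ same_block_sym] by blast
qed blast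

section \<open>Adjoining and deleting the last point\<close>

lemma partition_on_adjoin_to_first:
  assumes \<sigma>: "partition_on {1..n - 1} \<sigma>" and n: "n \<ge> 2"
  shows "partition_on {1..n} (adjoin_to_first n \<sigma>)"
proof (rule partition_onI)
  have un: "\<Union>\<sigma> = {1..n - 1}"
    using partition_onD1[OF \<sigma>] by simp
  moreover have "1 \<in> {1..n - 1}"
    using n by auto
  ultimately obtain B where B: "B \<in> \<sigma>" "1 \<in> B"
    by blast
  have "\<Union>(adjoin_to_first n \<sigma>) = insert n (\<Union>\<sigma>)"
    using B by (auto simp: adjoin_to_first_def split: if_splits)
  also have "\<dots> = {1..n}"
    unfolding un using n by auto
  finally show "\<Union>(adjoin_to_first n \<sigma>) = {1..n}" .
  show "{} \<notin> adjoin_to_first n \<sigma>"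
    using partition_onD3[OF \<sigma>] by (auto simp: adjoin_to_first_def split: if_splits)
  have notin: "n \<notin> \<Union>\<sigma>"
    unfolding un using n by auto
  show "disjnt p q"
    if pq: "p \<in> adjoin_to_first n \<sigma>" "q \<in> adjoin_to_first n \<sigma>" "p \<noteq> q" for p q
  proof -
    obtain B C where BC: "B \<in> \<sigma>" "C \<in> \<sigma>"
      and p: "p = (if 1 \<in> B then insert n B else B)" and q: "q = (if 1 \<in> C then insert n C else C)"
      using pq(1,2) unfolding adjoin_to_first_def by blast
    have "\<not> (x \<in> B \<and> x \<in> C)" for x
      using partition_on_block_eq[OF \<sigma> BC] pq(3) p q by blast
    moreover have "n \<notin> B" "n \<notin> C"
      using notin BC by blast+
    ultimately show ?thesis
      unfolding p q disjnt_iff by (simp split: if_split) blast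
  qed
qed

text \<open>The new point \<open>n\<close> acts as a second copy of 1, and every other index keeps
  its meaning. Conditions (a), (b) and (c) are carried between the two partitions through this
  dictionary.\<close>

lemma same_block_adjoin_to_first:
  assumes \<sigma>: "partition_on {1..n - 1} \<sigma>" and n: "n \<ge> 2"
  shows "same_block (adjoin_to_first n \<sigma>) i j \<longleftrightarrow>
    same_block \<sigma> (if i = n then 1 else i) (if j = n then 1 else j)"
proof -
  have "n \<notin> \<Union>\<sigma>"
    unfolding partition_onD1[OF \<sigma>, symmetric] using n by auto
  then show ?thesis
    by (auto simp: same_block_def adjoin_to_first_def)
qed

text \<open>A plain image would turn a block \<open>{n}\<close> into the empty set; the map is
  applied only where \<open>n\<close> shares its block with 1, so this does not occur.\<close>

definition delete_last :: "nat \<Rightarrow> nat set set \<Rightarrow> nat set set" where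
  "delete_last n \<pi> = (\<lambda>B. B - {n}) ` \<pi>"

lemma delete_last_adjoin_to_first:
  assumes "partition_on {1..n - 1} \<sigma>" "n \<ge> 2"
  shows "delete_last n (adjoin_to_first n \<sigma>) = \<sigma>"
proof -
  have "n \<notin> \<Union>\<sigma>"
    unfolding partition_onD1[OF assms(1), symmetric] using assms(2) by auto
  then have "(\<lambda>B. (if 1 \<in> B then insert n B else B) - {n}) ` \<sigma> = id ` \<sigma>"
    by (intro image_cong) auto
  then show ?thesis
    by (simp only: delete_last_def adjoin_to_first_def image_image image_id id_apply)
qed

lemma mem_first_iff_mem_last:
  assumes "partition_on {1..n} \<pi>" "same_block \<pi> 1 n" "B \<in> \<pi>"
  shows "1 \<in> B \<longleftrightarrow> n \<in> B"
  using assms(2,3) partition_on_block_eq[OF assms(1)] unfolding same_block_def by metis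

text \<open>The block that loses \<open>n\<close> is exactly the one containing 1, so the test for 1
  gives \<open>n\<close> back to the right block.\<close>

lemma adjoin_to_first_delete_last:
  assumes "partition_on {1..n} \<pi>" "same_block \<pi> 1 n" "n \<ge> 2"
  shows "adjoin_to_first n (delete_last n \<pi>) = \<pi>"
proof -
  have "(\<lambda>B. if 1 \<in> B - {n} then insert n (B - {n}) else B - {n}) ` \<pi> = id ` \<pi>"
    using mem_first_iff_mem_last[OF assms(1,2)] assms(3) by (intro image_cong) auto
  then show ?thesis
    by (simp only: delete_last_def adjoin_to_first_def image_image image_id id_apply)
qed

lemma partition_on_delete_last:
  assumes \<pi>: "partition_on {1..n} \<pi>" and "same_block \<pi> 1 n" "n \<ge> 2"
  shows "partition_on {1..n - 1} (delete_last n \<pi>)"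
proof (rule partition_onI)
  have "\<Union>(delete_last n \<pi>) = \<Union>\<pi> - {n}"
    by (auto simp: delete_last_def)
  also have "\<dots> = {1..n - 1}"
    unfolding partition_onD1[OF \<pi>, symmetric] by auto
  finally show "\<Union>(delete_last n \<pi>) = {1..n - 1}" .
  \<comment> \<open>A block containing \<open>n\<close> also contains 1, which differs from
    \<open>n\<close> and survives the deletion.\<close>
  have "B - {n} \<noteq> {}" if "B \<in> \<pi>" for B
  proof -
    have "B \<noteq> {}"
      using that partition_onD3[OF \<pi>] by auto
    then show ?thesis
      using mem_first_iff_mem_last[OF assms(1,2) that] assms(3) by fastforce
  qed
  then show "{} \<notin> delete_last n \<pi>"
    by (metis (no_types, lifting) delete_last_def imageE)
  show "disjnt p q" if "p \<in> delete_last n \<pi>" "q \<in> delete_last n \<pi>" "p \<noteq> q" for p q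
    using that partition_on_block_eq[OF \<pi>]
    by (auto simp: delete_last_def disjnt_iff)
qed

section \<open>The bijection from \<open>PC (n - 1)\<close> onto
  \<open>PC_plus n - PC n\<close>\<close>

lemma adjoin_to_first_in_PC_plus:
  assumes "\<sigma> \<in> PC (n - 1)" and n: "n \<ge> 2"
  shows "adjoin_to_first n \<sigma> \<in> PC_plus n - PC n"
proof -
  let ?\<pi> = "adjoin_to_first n \<sigma>"
  have \<sigma>: "partition_on {1..n - 1} \<sigma>" and int: "no_interval_splits (n - 1) \<sigma>"
    and nb: "no_neighbours (n - 1) \<sigma>" and c: "\<not> same_block \<sigma> 1 (n - 1)"
    using assms by (auto simp: PC_def)
  note \<pi> = partition_on_adjoin_to_first[OF \<sigma> n]
  note sb = same_block_adjoin_to_first[OF \<sigma> n]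
  have ends: "same_block ?\<pi> 1 n"
    using n same_block_refl_iff[OF \<sigma>, of 1] by (simp add: sb)
  have "no_neighbours n ?\<pi>"
    unfolding no_neighbours_def
  proof
    fix k assume k: "k \<in> {1..n - 1}"
    show "\<not> same_block ?\<pi> k (k + 1)"
    proof (cases "k + 1 = n")
      case True
      then show ?thesis
        using c same_block_sym[of \<sigma> k 1] by (auto simp: sb)
    next
      case False
      then show ?thesis
        using nb k by (auto simp: sb no_neighbours_def)
    qed
  qed
  moreover have "no_interval_splits n ?\<pi>"
    unfolding no_interval_splits_def
  proof (intro allI impI notI)
    fix p q assume pq: "p < p + q \<and> p + q \<le> n \<and> q < n" and sp: "splits {p + 1..p + q} ?\<pi>"
    note cl = splitsD[OF \<pi> sp]
    \<comment> \<open>A splitting interval with \<open>n\<close> in it would contain 1 too, hence be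
      all of \<open>{1..n}\<close>, against \<open>q < n\<close>.\<close>
    have "n \<notin> {p + 1..p + q}"
      using cl[of n 1] same_block_sym[OF ends] pq by auto
    then have le: "p + q \<le> n - 1"
      using pq by auto
    \<comment> \<open>Containing 1 would force containing \<open>n\<close>. So
      \<open>p \<ge> 1\<close>, which makes the interval proper in \<open>{1..n - 1}\<close> as
      well.\<close>
    have "1 \<notin> {p + 1..p + q}"
      using cl[of 1 n] ends \<open>n \<notin> _\<close> by auto
    then have "q < n - 1"
      using pq le by auto
    moreover have "splits {p + 1..p + q} \<sigma>"
    proof (rule splitsI[OF \<sigma>])
      show "{p + 1..p + q} \<subseteq> {1..n - 1}"
        using le by auto
      fix i j assume i: "i \<in> {p + 1..p + q}" and ij: "same_block \<sigma> i j"
      have "i \<noteq> n" "j \<noteq> n"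
        using same_block_mem[OF \<sigma> ij] n by auto
      then show "j \<in> {p + 1..p + q}"
        using cl[OF i, of j] ij by (simp add: sb)
    qed
    ultimately show False
      using int pq le unfolding no_interval_splits_def by blast
  qed
  ultimately show ?thesis
    using \<pi> n ends by (auto simp: PC_plus_def PC_def)
qed

lemma delete_last_in_PC:
  assumes "\<pi> \<in> PC_plus n - PC n" and n: "n \<ge> 2"
  shows "delete_last n \<pi> \<in> PC (n - 1)" and "adjoin_to_first n (delete_last n \<pi>) = \<pi>"
proof -
  let ?\<sigma> = "delete_last n \<pi>"
  have \<pi>: "partition_on {1..n} \<pi>" and int: "no_interval_splits n \<pi>"
    and nb: "no_neighbours n \<pi>" and ends: "same_block \<pi> 1 n"
    using assms by (auto simp: PC_def PC_plus_def)
  show adj: "adjoin_to_first n ?\<sigma> = \<pi>"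
    by (rule adjoin_to_first_delete_last[OF \<pi> ends n])
  note \<sigma> = partition_on_delete_last[OF \<pi> ends n]
  note sb = same_block_adjoin_to_first[OF \<sigma> n, unfolded adj]
  \<comment> \<open>Since \<open>p > 0\<close>, the interval avoids 1. No point of it is then
    related to \<open>n\<close>, the copy of 1, so it stays closed in the larger partition.\<close>
  have no_split: False
    if pq: "0 < p" "0 < q" "p + q \<le> n - 1" and sp: "splits {p + 1..p + q} ?\<sigma>" for p q
  proof -
    have "splits {p + 1..p + q} \<pi>"
    proof (rule splitsI[OF \<pi>])
      show "{p + 1..p + q} \<subseteq> {1..n}"
        using pq by auto
      fix i j assume i: "i \<in> {p + 1..p + q}" and ij: "same_block \<pi> i j"
      have "i \<noteq> n"
        using i pq n by auto
      then have "(if j = n then 1 else j) \<in> {p + 1..p + q}"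
        using splitsD[OF \<sigma> sp i] ij by (simp add: sb)
      then show "j \<in> {p + 1..p + q}"
        using pq by (auto split: if_splits)
    qed
    then show False
      using int[unfolded no_interval_splits_def, rule_format, of p q] pq by linarith
  qed
  have "no_neighbours (n - 1) ?\<sigma>"
    unfolding no_neighbours_def
  proof
    fix k assume "k \<in> {1..n - 1 - 1}"
    then have "k \<in> {1..n - 1}" "k \<noteq> n" "k + 1 \<noteq> n"
      by auto
    then show "\<not> same_block ?\<sigma> k (k + 1)"
      using nb sb[of k "k + 1"] unfolding no_neighbours_def by metis
  qed
  moreover have "\<not> same_block \<pi> (n - 1) n"
    using nb[unfolded no_neighbours_def, rule_format, of "n - 1"] n by auto
  then have "\<not> same_block ?\<sigma> 1 (n - 1)"
    using n sb[of "n - 1" n] same_block_sym[of ?\<sigma> 1 "n - 1"]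
    by (auto split: if_splits)
  moreover have "no_interval_splits (n - 1) ?\<sigma>"
    unfolding no_interval_splits_def
  proof (intro allI impI notI)
    fix p q assume pq: "p < p + q \<and> p + q \<le> n - 1 \<and> q < n - 1"
      and sp: "splits {p + 1..p + q} ?\<sigma>"
    show False
    proof (cases "p = 0")
      case True
      \<comment> \<open>An interval starting at 1 is out of reach of \<open>no_split\<close>, but
        its complement in \<open>{1..n - 1}\<close> is again an interval: it starts at
        \<open>q + 1 > 1\<close> and is nonempty because \<open>q < n - 1\<close>.\<close>
      have "splits ({1..n - 1} - {p + 1..p + q}) ?\<sigma>"
        by (rule splits_Diff[OF \<sigma> sp])
      moreover have "{1..n - 1} - {p + 1..p + q} = {q + 1..q + (n - 1 - q)}"
        using pq True by auto
      ultimately show False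
        using pq True by (intro no_split[of q "n - 1 - q"]) auto
    next
      case False
      then show False
        using no_split[of p q] pq sp by auto
    qed
  qed
  ultimately show "?\<sigma> \<in> PC (n - 1)"
    using \<sigma> n by (auto simp: PC_def)
qed

lemma inj_on_adjoin_to_first: "n \<ge> 2 \<Longrightarrow> inj_on (adjoin_to_first n) (PC (n - 1))"
  by (rule inj_on_inverseI[where g = "delete_last n"])
     (auto simp: PC_def delete_last_adjoin_to_first)

lemma bij_betw_adjoin_to_first:
  assumes "n \<ge> 2"
  shows "bij_betw (adjoin_to_first n) (PC (n - 1)) (PC_plus n - PC n)"
proof (rule bij_betwI')
  show "\<And>\<sigma> \<tau>. \<lbrakk>\<sigma> \<in> PC (n - 1); \<tau> \<in> PC (n - 1)\<rbrakk>
      \<Longrightarrow> adjoin_to_first n \<sigma> = adjoin_to_first n \<tau> \<longleftrightarrow> \<sigma> = \<tau>"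
    using inj_on_adjoin_to_first[OF assms] by (auto dest: inj_onD)
  show "\<And>\<sigma>. \<sigma> \<in> PC (n - 1) \<Longrightarrow> adjoin_to_first n \<sigma> \<in> PC_plus n - PC n"
    using adjoin_to_first_in_PC_plus assms by blast
  show "\<exists>\<sigma>\<in>PC (n - 1). \<pi> = adjoin_to_first n \<sigma>" if "\<pi> \<in> PC_plus n - PC n" for \<pi>
    using delete_last_in_PC[OF that assms] by metis
qed

section \<open>Weights and their sums for \<open>n \<ge> 2\<close>\<close>

lemma PC_subset_PC_plus: "PC n \<subseteq> PC_plus n"
  by (auto simp: PC_def PC_plus_def)

text \<open>Excludes the first branch of \<open>b_weight\<close>, which is tested before membership
  in \<open>PC n\<close>.\<close>

lemma PC_plus_neq_singleton:
  assumes "\<pi> \<in> PC_plus n" "n \<ge> 2"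
  shows "\<pi> \<noteq> {{1}}"
proof
  assume "\<pi> = {{1}}"
  then have "partition_on {1..n} {{1}}"
    using assms(1) unfolding PC_plus_def by blast
  then have "{1..n} = \<Union>{{1}}"
    by (rule partition_onD1)
  moreover have "n \<in> {1..n}" "n \<notin> \<Union>{{1}}"
    using assms(2) by auto
  ultimately show False
    by blast
qed

lemma b_weight_adjoin_to_first:
  assumes \<sigma>: "\<sigma> \<in> PC (n - 1)" and n: "n \<ge> 2"
  shows "b_weight a n (adjoin_to_first n \<sigma>) = a \<sigma>"
proof -
  have \<pi>: "adjoin_to_first n \<sigma> \<in> PC_plus n" "adjoin_to_first n \<sigma> \<notin> PC n"
    using adjoin_to_first_in_PC_plus[OF assms] by auto
  have "adjoin_to_first n \<sigma> \<noteq> {{1}}"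
    by (rule PC_plus_neq_singleton[OF \<pi>(1) n])
  \<comment> \<open>Injectivity on \<open>PC (n - 1)\<close> gives the uniqueness that the
    description operator needs.\<close>
  moreover have "(THE \<tau>. \<tau> \<in> PC (n - 1) \<and> adjoin_to_first n \<sigma> = adjoin_to_first n \<tau>) = \<sigma>"
    using \<sigma> inj_onD[OF inj_on_adjoin_to_first[OF n]] by (intro the_equality) metis+
  ultimately show ?thesis
    using \<pi>(2) by (simp add: b_weight_def)
qed

lemma b_weight_PC:
  assumes "\<pi> \<in> PC n" "n \<ge> 2"
  shows "b_weight a n \<pi> = a \<pi>"
proof -
  have "\<pi> \<noteq> {{1}}"
    using assms PC_subset_PC_plus PC_plus_neq_singleton by blast
  then show ?thesis
    using assms(1) by (simp add: b_weight_def)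
qed

lemma finite_PC_plus: "finite (PC_plus n)"
  by (rule finite_subset[OF _ finitely_many_partition_on[of "{1..n}"]]) (auto simp: PC_plus_def)

lemma b_sum_eq:
  assumes n: "n \<ge> 2"
  shows "b_sum a n = a_sum a n + a_sum a (n - 1)"
proof -
  have "b_sum a n =
      (\<Sum>\<pi>\<in>PC_plus n - PC n. b_weight a n \<pi>) + (\<Sum>\<pi>\<in>PC n. b_weight a n \<pi>)"
    unfolding b_sum_def by (rule sum.subset_diff[OF PC_subset_PC_plus finite_PC_plus])
  also have "(\<Sum>\<pi>\<in>PC_plus n - PC n. b_weight a n \<pi>) = a_sum a (n - 1)"
    unfolding a_sum_def sum.reindex_bij_betw[OF bij_betw_adjoin_to_first[OF n], symmetric]
    using n by (simp add: b_weight_adjoin_to_first)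
  also have "(\<Sum>\<pi>\<in>PC n. b_weight a n \<pi>) = a_sum a n"
    unfolding a_sum_def using n by (simp add: b_weight_PC)
  finally show ?thesis
    by simp
qed

section \<open>The case \<open>n = 1\<close> and the generating series\<close>

lemma PC_1: "PC 1 = {}"
  by (auto simp: PC_def same_block_refl_iff)

lemma partition_on_singleton_iff: "partition_on {x} \<pi> \<longleftrightarrow> \<pi> = {{x}}"
proof
  assume \<pi>: "partition_on {x} \<pi>"
  have "B = {x}" if "B \<in> \<pi>" for B
  proof -
    have "B \<subseteq> {x}" "B \<noteq> {}"
      using that partition_onD1[OF \<pi>] partition_onD3[OF \<pi>] by blast+
    then show ?thesis
      by blast
  qed
  moreover have "\<pi> \<noteq> {}"
    using partition_onD1[OF \<pi>] by auto
  ultimately show "\<pi> = {{x}}"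
    by blast
qed (auto simp: partition_on_def)

text \<open>Conditions (a) and (b) are vacuous here: no \<open>q\<close> satisfies
  \<open>0 < q < 1\<close>, and \<open>{1..0}\<close> is empty.\<close>

lemma PC_plus_1: "PC_plus 1 = {{{1}}}"
  by (auto simp: PC_plus_def partition_on_singleton_iff no_interval_splits_def no_neighbours_def)

lemma b_sum_1: "b_sum a 1 = 1"
  unfolding b_sum_def PC_plus_1 by (simp add: b_weight_def)

lemma B_series_eq: "B_series a = fps_X + (1 + fps_X) * A_series a"
proof (rule fps_ext)
  fix n :: nat
  consider "n = 0" | "n = 1" | "n \<ge> 2"
    by linarith
  then show "fps_nth (B_series a) n = fps_nth (fps_X + (1 + fps_X) * A_series a) n"
  proof cases
    \<comment> \<open>On the right only \<open>fps_X\<close> contributes: \<open>a_sum a 1\<close>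
      is an empty sum, and the constant coefficient of \<open>A_series a\<close> is 0 by
      definition.\<close>
    case 2
    then show ?thesis
      using b_sum_1 PC_1
      by (simp add: B_series_def A_series_def distrib_right a_sum_def)
  qed (auto simp: B_series_def A_series_def distrib_right b_sum_eq)
qed

theorem lemma2p3:
  fixes a :: "nat set set \<Rightarrow> complex"
  shows "b_sum a 1 = 1 \<and>
    (\<forall>n\<ge>2. b_sum a n = a_sum a n + a_sum a (n - 1)) \<and>
    B_series a = fps_X + (1 + fps_X) * A_series a"
  using b_sum_1 b_sum_eq B_series_eq by blast

end
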